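(* Let $1\le n\le N$ be integers, $\alpha,\beta>-1$, $\delta>0$, and $\operatorname{Re}\nu<n$. Let $f$ be a function on $\mathbb{R}$ for which the infinite sum defining the fractional summation $I_\delta^{\nu-n}[f]$ converges. Then the approximate fractional Hahn difference of $f$ is given by $$I_{\delta,n,w}^{\nu}[f](x)=\frac{\Gamma(n+1)}{\Gamma(N+1)}\,\frac{\Gamma(2n+\alpha+\beta+2)}{\Gamma(N+n+\alpha+\beta+2)}\,\frac{\Gamma(N+1+\beta)}{\Gamma(n+1+\beta)}\,\frac{1}{\delta^\nu}\sum_{m=1}^{\infty}f(x-m\delta)\,\frac{(-\nu)_{m+n}}{(m+n)!}\;{}_3F_2\!\left({n-N,\;n+\alpha+1,\;m+n-\nu\atop -N-\beta,\;m+n+1};1\right)$$ $$+\frac{\Gamma(n+1)}{\Gamma(N+1)}\,\frac{\Gamma(2n+\alpha+\beta+2)}{\Gamma(N+n+\alpha+\beta+2)}\,\frac{\Gamma(\alpha+N+1)}{\Gamma(\alpha+n+1)}\,\frac{1}{\delta^\nu}\sum_{m=0}^{N}f(x+m\delta)\,\frac{(-\nu)_{N-m}}{(N-m)!}\;{}_3F_2\!\left({n-N,\;\beta+n+1,\;-N+m\atop -\alpha-N,\;\nu-N+m+1};1\right).$$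
   Context: $(a)_k=a(a+1)\cdots(a+k-1)$. The first ${}_3F_2$ is the terminating series $\sum_{i=0}^{N-n}$ and the second is the terminating series $\sum_{i=0}^{\min(N-n,N-m)}$ of the usual terms $\frac{(a_1)_i(a_2)_i(a_3)_i}{(b_1)_i(b_2)_i\,i!}$. When $\nu$ is a nonnegative integer, the product of $\frac{(-\nu)_{N-m}}{(N-m)!}$ with the second ${}_3F_2$ is interpreted by continuity in $\nu$. Hahn polynomials: $Q_n(j;\alpha,\beta,N)={}_3F_2\!\left({-j,\,-n,\,n+\alpha+\beta+1\atop \alpha+1,\,-N};1\right)=\sum_{k=0}^{n}\frac{(-n)_k(n+\alpha+\beta+1)_k(-j)_k}{(\alpha+1)_k(-N)_k\,k!}$, orthogonal on $\{0,1,\ldots,N\}$ with respect to the weights $w(j)=\frac{(\alpha+1)_j(\beta+1)_{N-j}}{j!\,(N-j)!}$. Let $k_n$ be the leading coefficient of $Q_n(\cdot;\alpha,\beta,N)$ and $h_n=\sum_{j=0}^NQ_n(j;\alpha,\beta,N)^2w(j)$. Fractional summation: $I_\delta^{-\mu}[f](x)=\delta^\mu\sum_{k=0}^\infty\frac{(\mu)_k}{k!}f(x-k\delta)$; for $\mu\ne0,-1,-2,\ldots$ the sum converges if $f(x)=O(|x|^{-\lambda})$ as $x\to-\infty$ with $\lambda>\operatorname{Re}\mu$. Approximate orthogonal derivative: $D_\delta^n[f](x)=\frac{k_n\,n!}{h_n}\frac{1}{\delta^n}\sum_{j=0}^Nf(x+j\delta)\,w(j)\,Q_n(j;\alpha,\beta,N)$.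 Approximate fractional (Hahn) difference, for $\operatorname{Re}\nu<n$: $I_{\delta,n,w}^\nu[f](x):=D_\delta^n\big[I_\delta^{\nu-n}[f]\big](x)$.
   Formalization: The overall factor Γ(n+1)/Γ(N+1) before both sums is dropped: with it the formula fails for n<N (for n=1, N=2, α=β=0, δ=1 the coefficient of f(x+2) is 1/2, but the printed formula gives 1/4). *)

theory Defs
  imports "HOL-Analysis.Analysis" "HOL-Computational_Algebra.Polynomial"
begin

text \<open>The partial sum up to index \<open>M\<close> of the series \<open>3F2(a1, a2, a3; b1, b2; 1)\<close>. The explicit
  truncation matters where a lower parameter is a nonpositive integer: division by zero then
  only affects terms beyond \<open>M\<close>.\<close>

definition hyp3F2 :: "nat \<Rightarrow> 'a::field_char_0 \<Rightarrow> 'a \<Rightarrow> 'a \<Rightarrow> 'a \<Rightarrow> 'a \<Rightarrow> 'a" where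
  "hyp3F2 M a1 a2 a3 b1 b2 =
     (\<Sum>i\<le>M. pochhammer a1 i * pochhammer a2 i * pochhammer a3 i /
            (pochhammer b1 i * pochhammer b2 i * fact i))"

text \<open>\<open>pochhammer [:0, -1:] k\<close> is \<open>(-x)\<^sub>k\<close> as a polynomial in \<open>x\<close>.\<close>

definition hahn_poly :: "real \<Rightarrow> real \<Rightarrow> nat \<Rightarrow> nat \<Rightarrow> real poly" where
  "hahn_poly \<alpha> \<beta> N n =
     (\<Sum>k\<le>n. smult (pochhammer (- real n) k * pochhammer (real n + \<alpha> + \<beta> + 1) k /
                   (pochhammer (\<alpha> + 1) k * pochhammer (- real N) k * fact k))
              (pochhammer [:0, -1:] k))"

lemma poly_hahn_poly:
  "poly (hahn_poly \<alpha> \<beta> N n) x =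
     hyp3F2 n (- x) (- real n) (real n + \<alpha> + \<beta> + 1) (\<alpha> + 1) (- real N)"
proof -
  have "poly (pochhammer [:0, -1:] k) x = pochhammer (- x) k" for k
    by (simp add: pochhammer_prod poly_prod)
  then show ?thesis
    by (simp add: hahn_poly_def hyp3F2_def poly_sum mult_ac)
qed

definition hahn_weight :: "real \<Rightarrow> real \<Rightarrow> nat \<Rightarrow> nat \<Rightarrow> real" where
  "hahn_weight \<alpha> \<beta> N j =
     pochhammer (\<alpha> + 1) j * pochhammer (\<beta> + 1) (N - j) / (fact j * fact (N - j))"

definition hahn_norm :: "real \<Rightarrow> real \<Rightarrow> nat \<Rightarrow> nat \<Rightarrow> real" where
  "hahn_norm \<alpha> \<beta> N n = (\<Sum>j\<le>N. (poly (hahn_poly \<alpha> \<beta> N n) (real j))\<^sup>2 * hahn_weight \<alpha> \<beta> N j)"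

definition frac_summable :: "real \<Rightarrow> complex \<Rightarrow> (real \<Rightarrow> complex) \<Rightarrow> real \<Rightarrow> bool" where
  "frac_summable \<delta> \<mu> f x \<longleftrightarrow>
     summable (\<lambda>k. pochhammer \<mu> k / fact k * f (x - real k * \<delta>))"

text \<open>\<open>frac_sum \<delta> \<mu> f\<close> is the fractional summation of order \<open>\<mu>\<close>, that is \<open>I\<^sub>\<delta>\<close> with
  superscript \<open>-\<mu>\<close>.\<close>

definition frac_sum :: "real \<Rightarrow> complex \<Rightarrow> (real \<Rightarrow> complex) \<Rightarrow> real \<Rightarrow> complex" where
  "frac_sum \<delta> \<mu> f x =
     of_real \<delta> powr \<mu> * (\<Sum>k. pochhammer \<mu> k / fact k * f (x - real k * \<delta>))"

definition approx_deriv ::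
    "real \<Rightarrow> real \<Rightarrow> nat \<Rightarrow> nat \<Rightarrow> real \<Rightarrow> (real \<Rightarrow> complex) \<Rightarrow> real \<Rightarrow> complex" where
  "approx_deriv \<alpha> \<beta> N n \<delta> f x =
     of_real (lead_coeff (hahn_poly \<alpha> \<beta> N n) * fact n / hahn_norm \<alpha> \<beta> N n * (1 / \<delta> ^ n)) *
     (\<Sum>j\<le>N. f (x + real j * \<delta>) *
        of_real (hahn_weight \<alpha> \<beta> N j * poly (hahn_poly \<alpha> \<beta> N n) (real j)))"

definition hahn_difference ::
    "real \<Rightarrow> real \<Rightarrow> nat \<Rightarrow> nat \<Rightarrow> real \<Rightarrow> complex \<Rightarrow> (real \<Rightarrow> complex) \<Rightarrow> real \<Rightarrow> complex" where
  "hahn_difference \<alpha> \<beta> N n \<delta> \<nu> f =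
     approx_deriv \<alpha> \<beta> N n \<delta> (frac_sum \<delta> (of_nat n - \<nu>) f)"

text \<open>The published closed form of \<^const>\<open>hahn_difference\<close> carries an extra overall factor
  \<open>\<Gamma>(n+1) / \<Gamma>(N+1)\<close>, which is an error for \<open>n < N\<close> and is omitted from the theorem.
  \<^const>\<open>approx_deriv\<close> is invariant under rescaling of the weights and of the polynomials, so no
  choice of normalization produces the factor. For \<open>n = 1\<close>, \<open>N = 2\<close>, \<open>\<alpha> = \<beta> = 0\<close> and \<open>\<delta> = 1\<close>
  the coefficient of \<open>f(x + 2)\<close> is \<open>1/2\<close>; with the factor it would be \<open>1/4\<close>.\<close>

definition forward_term :: "real \<Rightarrow> real \<Rightarrow> nat \<Rightarrow> nat \<Rightarrow> nat \<Rightarrow> complex \<Rightarrow> complex" where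
  "forward_term \<alpha> \<beta> N n m \<nu> =
     pochhammer (- \<nu>) (N - m) / fact (N - m) *
     hyp3F2 (min (N - n) (N - m))
       (of_nat n - of_nat N) (of_real \<beta> + of_nat n + 1) (of_nat m - of_nat N)
       (- of_real \<alpha> - of_nat N) (\<nu> - of_nat N + of_nat m + 1)"

text \<open>At nonnegative integers \<open>\<nu>\<close> the last lower parameter of \<^const>\<open>forward_term\<close> may be a
  nonpositive integer, while the prefactor vanishes; there the product is read as its limit.\<close>

definition forward_coeff :: "real \<Rightarrow> real \<Rightarrow> nat \<Rightarrow> nat \<Rightarrow> nat \<Rightarrow> complex \<Rightarrow> complex" where
  "forward_coeff \<alpha> \<beta> N n m \<nu> =
     (if \<nu> \<in> \<nat> then Lim (at \<nu>) (forward_term \<alpha> \<beta> N n m) else forward_term \<alpha> \<beta> N n m \<nu>)"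

end

(* Let V(z) be the generating polynomial of the Hahn weights with parameters \<alpha>+n, \<beta>+n, N-n. The
   Rodrigues formula says that \<Sum>\<^sub>j w(j) Q\<^sub>n(j) z^j is a nonzero multiple of (1-z)^n V(z): both sides have
   coefficients w(j) times a polynomial of degree at most n that is orthogonal to all lower degrees.
   Multiplication by 1-z is adjoint to a backward difference, and the backward difference of a
   fractional sum of order \<mu> is a fractional sum of order \<mu>-1. Hence the Hahn difference is a
   V-weighted sum of fractional sums of order -\<nu>, normalized by V(1), which Chu-Vandermonde evaluates;
   the multiple in the Rodrigues formula cancels against h\<^sub>n. Separating the arguments x - m\<delta> with m > 0
   from x + m\<delta> with m >= 0 and reflecting the Pochhammer symbols gives the two hypergeometric sums. *)

theory Submission
  imports Defs
begin

section \<open>Generating polynomials of the Hahn weights\<close>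

text \<open>Multiplying (1-z)^(-a-1) by 1-z gives (1-z)^(-a); this compares coefficients of z^(k+1).
  It drives both the difference of Hahn weights and the lowering of the order of a fractional
  sum.\<close>

lemma pochhammer_fact_diff:
  fixes a :: "'a::field_char_0"
  shows "pochhammer (a + 1) (Suc k) / fact (Suc k) - pochhammer (a + 1) k / fact k =
    pochhammer a (Suc k) / fact (Suc k)"
proof -
  have "pochhammer (a + 1) (Suc k) / fact (Suc k) - pochhammer (a + 1) k / fact k =
    (pochhammer (a + 1) (Suc k) - of_nat (Suc k) * pochhammer (a + 1) k) / fact (Suc k)"
    by (simp add: diff_divide_distrib del: of_nat_Suc)
  also have "\<dots> = pochhammer a (Suc k) / fact (Suc k)"
    by (simp add: pochhammer_rec' [of "a + 1"] pochhammer_rec [of a]) (simp add: algebra_simps)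
  finally show ?thesis .
qed

text \<open>Up to the sign (-1)^i, the second factor is the product of the last i factors of
  \<open>pochhammer b M\<close> in reverse order. The product form also covers vanishing
  factors.\<close>

lemma pochhammer_reflect:
  fixes b :: "'a::field_char_0"
  assumes "i \<le> M"
  shows "pochhammer b (M - i) * pochhammer (1 - b - of_nat M) i = (-1) ^ i * pochhammer b M"
proof -
  have "pochhammer (1 - b - of_nat M) i = (-1) ^ i * pochhammer (b + of_nat (M - i)) i"
    using pochhammer_minus [of "b + of_nat M - 1" i] assms by (simp add: of_nat_diff algebra_simps)
  then show ?thesis
    using pochhammer_product [of "M - i" M b] assms by (simp add: algebra_simps)
qed

lemma pochhammer_shift:
  fixes a :: "'a::field_char_0"
  assumes "a \<noteq> 0"
  shows "pochhammer (a + 1) k = (a + of_nat k) / a * pochhammer a k"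
  using pochhammer_rec [of a k] pochhammer_rec' [of a k] assms by (simp add: eq_divide_eq mult.commute)

text \<open>The coefficient of t^N in (1 - z t)^(-\<alpha>-1) (1 - t)^(-\<beta>-1), as a polynomial
  in z.\<close>

definition hahn_gen :: "real \<Rightarrow> real \<Rightarrow> nat \<Rightarrow> real poly" where
  "hahn_gen \<alpha> \<beta> N = (\<Sum>j\<le>N. monom (hahn_weight \<alpha> \<beta> N j) j)"

lemma coeff_hahn_gen: "coeff (hahn_gen \<alpha> \<beta> N) j = (if j \<le> N then hahn_weight \<alpha> \<beta> N j else 0)"
  by (simp add: hahn_gen_def coeff_sum sum.delta if_distrib cong: if_cong)

lemma hahn_weight_pos: "\<alpha> > -1 \<Longrightarrow> \<beta> > -1 \<Longrightarrow> hahn_weight \<alpha> \<beta> N j > 0"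
  by (simp add: hahn_weight_def pochhammer_pos)

text \<open>Chu-Vandermonde; this is the value of \<open>hahn_gen\<close> at z = 1.\<close>

lemma sum_hahn_weight:
  "(\<Sum>j\<le>N. hahn_weight \<alpha> \<beta> N j) = pochhammer (\<alpha> + \<beta> + 2) N / fact N"
proof -
  have "pochhammer (\<alpha> + \<beta> + 2) N = (\<Sum>j\<le>N. fact N * hahn_weight \<alpha> \<beta> N j)"
    using pochhammer_binomial_sum [of "\<alpha> + 1" "\<beta> + 1" N]
    by (auto simp: hahn_weight_def binomial_fact add_ac intro!: sum.cong)
  then show ?thesis by (simp flip: sum_distrib_left)
qed

section \<open>Multiplication of the generating polynomial by powers of 1 - z\<close>

lemma coeff_one_minus_X_mult:
  fixes p :: "'a::comm_ring_1 poly"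
  shows "coeff ([:1, -1:] * p) 0 = coeff p 0"
    and "coeff ([:1, -1:] * p) (Suc j) = coeff p (Suc j) - coeff p j"
  by simp_all

text \<open>In the generating function in t this is (1 - z t) - (1 - t) = t (1 - z); the factor t
  accounts for the step from \<open>M\<close> to \<open>Suc M\<close>. The proof compares
  coefficients.\<close>

lemma one_minus_X_mult_hahn_gen:
  "[:1, -1:] * hahn_gen (\<alpha> + 1) (\<beta> + 1) M = hahn_gen \<alpha> (\<beta> + 1) (Suc M) - hahn_gen (\<alpha> + 1) \<beta> (Suc M)"
proof (rule poly_eqI)
  fix j
  define c :: "real \<Rightarrow> nat \<Rightarrow> real" where "c a k = pochhammer a k / fact k" for a k
  have c0: "c a 0 = 1" for a by (simp add: c_def)
  have c_Suc: "c (a + 1) (Suc k) - c (a + 1) k = c a (Suc k)" for a k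
    unfolding c_def by (rule pochhammer_fact_diff)
  have w: "hahn_weight \<alpha>' \<beta>' N j = c (\<alpha>' + 1) j * c (\<beta>' + 1) (N - j)" for \<alpha>' \<beta>' N j
    by (simp add: hahn_weight_def c_def)
  show "coeff ([:1, -1:] * hahn_gen (\<alpha> + 1) (\<beta> + 1) M) j =
    coeff (hahn_gen \<alpha> (\<beta> + 1) (Suc M) - hahn_gen (\<alpha> + 1) \<beta> (Suc M)) j"
  proof (cases j)
    case 0
    then show ?thesis
      using c_Suc [of "\<beta> + 1" M]
      by (simp only: coeff_one_minus_X_mult coeff_diff) (simp add: coeff_hahn_gen w c0)
  next
    case (Suc i)
    \<comment> \<open>Index \<open>Suc M\<close> is the top one on the right; on the left only the
      subtracted coefficient at \<open>M\<close> survives there. Beyond it everything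
      vanishes.\<close>
    consider "i < M" | "i = M" | "i > M" by linarith
    then show ?thesis
    proof cases
      case 1
      then obtain k where k: "M = Suc (i + k)" using less_imp_Suc_add by auto
      have "c (\<alpha> + 1) (Suc i) = c (\<alpha> + 1 + 1) (Suc i) - c (\<alpha> + 1 + 1) i"
        "c (\<beta> + 1) (Suc k) = c (\<beta> + 1 + 1) (Suc k) - c (\<beta> + 1 + 1) k"
        by (simp_all only: c_Suc)
      then show ?thesis
        unfolding Suc coeff_one_minus_X_mult coeff_diff
        by (simp add: coeff_hahn_gen w k) (simp add: algebra_simps)
    next
      case 2
      show ?thesis
        unfolding Suc coeff_one_minus_X_mult coeff_diff
        using c_Suc [of "\<alpha> + 1" i]
        by (simp add: coeff_hahn_gen w c0 2)
    next
      case 3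
      then show ?thesis
        unfolding Suc coeff_one_minus_X_mult coeff_diff by (simp add: coeff_hahn_gen)
    qed
  qed
qed

text \<open>One half of the Rodrigues formula. Multiplying by one factor 1-z splits the generating
  polynomial into two with one parameter lowered; after the induction hypothesis, returning to the
  weight for \<alpha>, \<beta> costs a factor linear in j, so the degree grows by at most one per
  step.\<close>

lemma one_minus_X_power_mult_hahn_gen:
  assumes "\<alpha> > -1" and "\<beta> > -1"
  obtains q where "degree q \<le> n"
    and "\<And>j. j \<le> M + n \<Longrightarrow> coeff ([:1, -1:] ^ n * hahn_gen (\<alpha> + real n) (\<beta> + real n) M) j =
      hahn_weight \<alpha> \<beta> (M + n) j * poly q (real j)"
proof -
  have "\<exists>q. degree q \<le> n \<and>
    (\<forall>j\<le>M + n. coeff ([:1, -1:] ^ n * hahn_gen (\<alpha> + real n) (\<beta> + real n) M) j =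
      hahn_weight \<alpha> \<beta> (M + n) j * poly q (real j))"
    using assms
  proof (induction n arbitrary: \<alpha> \<beta> M)
    case 0
    show ?case
      by (rule exI [of _ 1]) (simp add: coeff_hahn_gen)
  next
    case (Suc n)
    obtain q1 where q1: "degree q1 \<le> n"
      "\<And>j. j \<le> Suc M + n \<Longrightarrow> coeff ([:1, -1:] ^ n * hahn_gen (\<alpha> + real n) (\<beta> + 1 + real n) (Suc M)) j =
        hahn_weight \<alpha> (\<beta> + 1) (Suc M + n) j * poly q1 (real j)"
      using Suc.IH [of \<alpha> "\<beta> + 1" "Suc M"] Suc.prems by auto
    obtain q2 where q2: "degree q2 \<le> n"
      "\<And>j. j \<le> Suc M + n \<Longrightarrow> coeff ([:1, -1:] ^ n * hahn_gen (\<alpha> + 1 + real n) (\<beta> + real n) (Suc M)) j =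
        hahn_weight (\<alpha> + 1) \<beta> (Suc M + n) j * poly q2 (real j)"
      using Suc.IH [of "\<alpha> + 1" \<beta> "Suc M"] Suc.prems by auto
    let ?N = "Suc M + n"
    \<comment> \<open>The linear factors, divided by \<beta>+1 and \<alpha>+1, are the ratios of the
      weights with \<beta> or \<alpha> raised by one to the original weight.\<close>
    define q where "q = smult (1 / (\<beta> + 1)) ([:\<beta> + 1 + real ?N, -1:] * q1)
      - smult (1 / (\<alpha> + 1)) ([:\<alpha> + 1, 1:] * q2)"
    have "degree q \<le> Suc n"
      unfolding q_def using q1(1) q2(1)
      by (intro degree_diff_le order.trans [OF degree_smult_le] order.trans [OF degree_mult_le]) auto
    moreover have "coeff ([:1, -1:] ^ Suc n * hahn_gen (\<alpha> + real (Suc n)) (\<beta> + real (Suc n)) M) j =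
      hahn_weight \<alpha> \<beta> ?N j * poly q (real j)" if j: "j \<le> ?N" for j
    proof -
      have "[:1, -1:] ^ Suc n * hahn_gen (\<alpha> + real (Suc n)) (\<beta> + real (Suc n)) M =
        [:1, -1:] ^ n * ([:1, -1:] * hahn_gen ((\<alpha> + real n) + 1) ((\<beta> + real n) + 1) M)"
        by (simp only: power_Suc2 mult.assoc of_nat_Suc add_ac)
      also have "\<dots> = [:1, -1:] ^ n * hahn_gen (\<alpha> + real n) (\<beta> + 1 + real n) (Suc M)
        - [:1, -1:] ^ n * hahn_gen (\<alpha> + 1 + real n) (\<beta> + real n) (Suc M)"
        unfolding one_minus_X_mult_hahn_gen right_diff_distrib by (simp only: add_ac)
      finally have "coeff ([:1, -1:] ^ Suc n * hahn_gen (\<alpha> + real (Suc n)) (\<beta> + real (Suc n)) M) j =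
        hahn_weight \<alpha> (\<beta> + 1) ?N j * poly q1 (real j) - hahn_weight (\<alpha> + 1) \<beta> ?N j * poly q2 (real j)"
        using q1(2) q2(2) j by (simp only: coeff_diff)
      moreover have "hahn_weight (\<alpha> + 1) \<beta> ?N j = (\<alpha> + 1 + real j) / (\<alpha> + 1) * hahn_weight \<alpha> \<beta> ?N j"
        using pochhammer_shift [of "\<alpha> + 1" j] Suc.prems by (simp add: hahn_weight_def)
      moreover have "hahn_weight \<alpha> (\<beta> + 1) ?N j =
        (\<beta> + 1 + (real ?N - real j)) / (\<beta> + 1) * hahn_weight \<alpha> \<beta> ?N j"
        using pochhammer_shift [of "\<beta> + 1" "?N - j"] Suc.prems j
        by (simp add: hahn_weight_def of_nat_diff)
      moreover have "poly q (real j) = (\<beta> + 1 + (real ?N - real j)) / (\<beta> + 1) * poly q1 (real j) -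
        (\<alpha> + 1 + real j) / (\<alpha> + 1) * poly q2 (real j)"
        by (simp add: q_def divide_inverse) (simp add: algebra_simps)
      ultimately show ?thesis by (simp only: right_diff_distrib mult_ac)
    qed
    ultimately show ?case by auto
  qed
  with that show ?thesis by blast
qed

text \<open>Summation by parts; the degree bound removes the boundary term. The sequence
  \<open>g\<close> may be real or complex: it is applied both to polynomial values and to fractional
  sums.\<close>

lemma sum_coeff_one_minus_X_mult:
  fixes p :: "real poly" and g :: "nat \<Rightarrow> 'a::real_normed_field"
  assumes "degree p \<le> M"
  shows "(\<Sum>j\<le>Suc M. of_real (coeff ([:1, -1:] * p) j) * g j) =
    (\<Sum>j\<le>M. of_real (coeff p j) * (g j - g (Suc j)))"
proof -
  have "(\<Sum>j\<le>Suc M. of_real (coeff ([:1, -1:] * p) j) * g j) =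
    of_real (coeff p 0) * g 0 + (\<Sum>j\<le>M. of_real (coeff p (Suc j)) * g (Suc j)) -
    (\<Sum>j\<le>M. of_real (coeff p j) * g (Suc j))"
    unfolding sum.atMost_Suc_shift coeff_one_minus_X_mult
    by (simp add: algebra_simps sum_subtractf)
  also have "of_real (coeff p 0) * g 0 + (\<Sum>j\<le>M. of_real (coeff p (Suc j)) * g (Suc j)) =
    (\<Sum>j\<le>Suc M. of_real (coeff p j) * g j)"
    unfolding sum.atMost_Suc_shift ..
  also have "\<dots> = (\<Sum>j\<le>M. of_real (coeff p j) * g j)"
    using assms by (simp add: coeff_eq_0)
  finally show ?thesis by (simp add: algebra_simps sum_subtractf)
qed

text \<open>The binomial expansion of p(x+1) in its two top coefficients. It shows that p(x) -
  p(x+1) loses the top degree and what its new top coefficient is.\<close>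

lemma coeff_pcompose_Suc:
  fixes p :: "real poly"
  assumes "degree p \<le> Suc k"
  shows "coeff (pcompose p [:1, 1:]) k = coeff p k + real (Suc k) * coeff p (Suc k)"
    and "coeff (pcompose p [:1, 1:]) (Suc k) = coeff p (Suc k)"
proof -
  have "coeff (pcompose p [:1, 1:]) k = coeff p k + real (Suc k) * coeff p (Suc k) \<and>
    coeff (pcompose p [:1, 1:]) (Suc k) = coeff p (Suc k)"
    using assms
  proof (induction p arbitrary: k)
    case 0
    show ?case by simp
  next
    case (pCons a p)
    \<comment> \<open>With this coefficient zero, only the shifted summand of \<open>rec\<close>
      contributes at index \<open>Suc k\<close>.\<close>
    have top: "coeff (pcompose p [:1, 1:]) (Suc k) = 0"
      using pCons.prems by (intro coeff_eq_0) (simp add: degree_pcompose split: if_splits)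
    have rec: "pcompose (pCons a p) [:1, 1:] = [:a:] + pcompose p [:1, 1:] + pCons 0 (pcompose p [:1, 1:])"
      by (simp add: pcompose_pCons)
    show ?case
    proof (cases k)
      case 0
      then have "degree p \<le> 0" using pCons.prems by (simp split: if_splits)
      then obtain b where "p = [:b:]" by (auto elim: degree_eq_zeroE)
      then show ?thesis using 0 by (simp add: pcompose_pCons)
    next
      case (Suc i)
      then have "degree p \<le> Suc i" using pCons.prems by (simp split: if_splits)
      from pCons.IH [OF this] top Suc show ?thesis
        unfolding rec by (simp add: algebra_simps)
    qed
  qed
  then show "coeff (pcompose p [:1, 1:]) k = coeff p k + real (Suc k) * coeff p (Suc k)"
    and "coeff (pcompose p [:1, 1:]) (Suc k) = coeff p (Suc k)" by auto
qed

text \<open>Summation by parts n times turns p into its n-th difference, which is constant. The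
  result vanishes below degree n, which gives orthogonality, and at degree n it gives the
  norm.\<close>

lemma sum_coeff_one_minus_X_power_mult:
  fixes p V :: "real poly"
  assumes "degree V \<le> M" and "degree p \<le> n"
  shows "(\<Sum>j\<le>M + n. coeff ([:1, -1:] ^ n * V) j * poly p (real j)) =
    (-1) ^ n * fact n * coeff p n * (\<Sum>j\<le>M. coeff V j)"
  using assms
proof (induction n arbitrary: p)
  case 0
  then obtain b where "p = [:b:]" by (auto elim: degree_eq_zeroE)
  then show ?case by (simp add: sum_distrib_left mult.commute)
next
  case (Suc n)
  let ?q = "p - pcompose p [:1, 1:]"
  have deg: "degree ([:1, -1:] ^ n * V) \<le> M + n"
    using Suc.prems(1) degree_mult_le [of "[:1, -1:] ^ n" V]
      degree_power_le [of "[:1, -1 :: real:]" n] by simp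
  have degq: "degree ?q \<le> n"
  proof (rule degree_le, intro allI impI)
    fix i assume "n < i"
    then consider "i = Suc n" | "i > Suc n" by linarith
    then show "coeff ?q i = 0"
    proof cases
      case 1
      then show ?thesis using coeff_pcompose_Suc(2) [OF Suc.prems(2)] by simp
    next
      case 2
      then show ?thesis using Suc.prems(2) by (simp add: coeff_eq_0 degree_pcompose)
    qed
  qed
  have "(\<Sum>j\<le>M + Suc n. coeff ([:1, -1:] ^ Suc n * V) j * poly p (real j)) =
    (\<Sum>j\<le>M + n. coeff ([:1, -1:] ^ n * V) j * (poly p (real j) - poly p (real (Suc j))))"
    using sum_coeff_one_minus_X_mult [OF deg, of "\<lambda>j. poly p (real j)"]
    unfolding power_Suc mult.assoc add_Suc_right of_real_eq_id id_apply .
  also have "\<dots> = (\<Sum>j\<le>M + n. coeff ([:1, -1:] ^ n * V) j * poly ?q (real j))"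
    by (simp add: poly_pcompose)
  also have "\<dots> = (-1) ^ n * fact n * coeff ?q n * (\<Sum>j\<le>M. coeff V j)"
    by (rule Suc.IH [OF Suc.prems(1) degq])
  also have "\<dots> = (-1) ^ Suc n * fact (Suc n) * coeff p (Suc n) * (\<Sum>j\<le>M. coeff V j)"
    by (simp add: coeff_pcompose_Suc [OF Suc.prems(2)])
  finally show ?case .
qed

text \<open>Factorial moments, up to sign. Absorbing one factor of (-j)_k into the weight raises
  \<alpha> and lowers the number of points, until Chu-Vandermonde applies.\<close>

lemma sum_hahn_weight_pochhammer:
  assumes "\<alpha> > -1" and "\<beta> > -1"
  shows "(\<Sum>j\<le>N. hahn_weight \<alpha> \<beta> N j * pochhammer (- real j) k) =
    pochhammer (- real N) k * pochhammer (\<alpha> + 1) k * pochhammer (\<alpha> + \<beta> + 2) N /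
    (pochhammer (\<alpha> + \<beta> + 2) k * fact N)"
  using assms
proof (induction k arbitrary: \<alpha> N)
  case 0
  show ?case by (simp add: sum_hahn_weight)
next
  case (Suc k)
  show ?case
  proof (cases N)
    case 0
    then show ?thesis by (simp add: pochhammer_0_left)
  next
    case (Suc L)
    \<comment> \<open>The factor -(j+1) cancels against (j+1)!, and \<alpha>+1 splits off the rising
      factorial. The term at index 0 is dropped later because (0)_(k+1) = 0.\<close>
    have w: "hahn_weight \<alpha> \<beta> (Suc L) (Suc j) * pochhammer (- real (Suc j)) (Suc k) =
      - (\<alpha> + 1) * (hahn_weight (\<alpha> + 1) \<beta> L j * pochhammer (- real j) k)" for j
      by (simp add: hahn_weight_def pochhammer_rec divide_simps) (simp add: algebra_simps)
    have pos: "\<alpha> + \<beta> + 2 > 0" using Suc.prems by simp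
    have "(\<Sum>j\<le>N. hahn_weight \<alpha> \<beta> N j * pochhammer (- real j) (Suc k)) =
      - (\<alpha> + 1) * (\<Sum>j\<le>L. hahn_weight (\<alpha> + 1) \<beta> L j * pochhammer (- real j) k)"
      unfolding Suc sum.atMost_Suc_shift w by (simp add: pochhammer_0_left sum_distrib_left)
    also have "\<dots> = - (\<alpha> + 1) * (pochhammer (- real L) k * pochhammer (\<alpha> + 1 + 1) k *
      pochhammer (\<alpha> + 1 + \<beta> + 2) L / (pochhammer (\<alpha> + 1 + \<beta> + 2) k * fact L))"
      using Suc.IH [of "\<alpha> + 1" L] Suc.prems by simp
    also have "\<dots> = pochhammer (- real N) (Suc k) * pochhammer (\<alpha> + 1) (Suc k) *
      pochhammer (\<alpha> + \<beta> + 2) N / (pochhammer (\<alpha> + \<beta> + 2) (Suc k) * fact N)"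
    proof -
      have 1: "pochhammer (- real (Suc L)) (Suc k) = - real (Suc L) * pochhammer (- real L) k"
        by (simp add: pochhammer_rec)
      have 2: "pochhammer (\<alpha> + \<beta> + 2) (Suc i) = (\<alpha> + \<beta> + 2) * pochhammer (\<alpha> + 1 + \<beta> + 2) i" for i
        by (simp add: pochhammer_rec add_ac)
      show ?thesis
        using pos unfolding Suc 1 2 pochhammer_rec [of "\<alpha> + 1" k] fact_Suc
        by (simp add: divide_simps del: of_nat_Suc) (simp add: algebra_simps)
    qed
    finally show ?thesis .
  qed
qed

section \<open>Hahn polynomials and the Rodrigues formula\<close>

lemma degree_pochhammer_poly: "degree (pochhammer [:0, -1 :: real:] k) \<le> k"
proof (induction k)
  case (Suc k)
  then show ?case
    unfolding pochhammer_rec' of_nat_poly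
    by (intro order.trans [OF degree_mult_le]) simp
qed simp

lemma coeff_pochhammer_poly: "coeff (pochhammer [:0, -1 :: real:] k) k = (-1) ^ k"
proof (induction k)
  case (Suc k)
  have "pochhammer [:0, -1 :: real:] (Suc k) = [:real k, -1:] * pochhammer [:0, -1:] k"
    unfolding pochhammer_rec' of_nat_poly by simp
  then show ?case
    using Suc degree_pochhammer_poly [of k] by (simp add: coeff_eq_0)
qed simp

lemma degree_hahn_poly_le: "degree (hahn_poly \<alpha> \<beta> N n) \<le> n"
  unfolding hahn_poly_def
  by (intro degree_sum_le order.trans [OF degree_smult_le] order.trans [OF degree_pochhammer_poly]) auto

lemma coeff_hahn_poly:
  "coeff (hahn_poly \<alpha> \<beta> N n) n = (-1) ^ n * (pochhammer (- real n) n * pochhammer (real n + \<alpha> + \<beta> + 1) n /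
    (pochhammer (\<alpha> + 1) n * pochhammer (- real N) n * fact n))"
proof -
  have "coeff (pochhammer [:0, -1 :: real:] k) n = 0" if "k < n" for k
    using degree_pochhammer_poly [of k] that by (intro coeff_eq_0) simp
  then have "coeff (hahn_poly \<alpha> \<beta> N n) n = (\<Sum>k\<le>n. if k = n then
      pochhammer (- real n) k * pochhammer (real n + \<alpha> + \<beta> + 1) k /
      (pochhammer (\<alpha> + 1) k * pochhammer (- real N) k * fact k) * (-1) ^ k else 0)"
    unfolding hahn_poly_def coeff_sum coeff_smult
    by (intro sum.cong) (auto simp: coeff_pochhammer_poly)
  then show ?thesis by simp
qed

lemma coeff_hahn_poly_nonzero:
  assumes "1 \<le> n" and "n \<le> N" and "\<alpha> > -1" and "\<beta> > -1"
  shows "coeff (hahn_poly \<alpha> \<beta> N n) n \<noteq> 0"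
proof -
  have "pochhammer (\<alpha> + 1) n > 0" "pochhammer (real n + \<alpha> + \<beta> + 1) n > 0"
    using assms by (auto intro!: pochhammer_pos)
  with assms show ?thesis
    by (simp add: coeff_hahn_poly pochhammer_of_nat_eq_0_iff)
qed

text \<open>These test functions merge with the weight and only raise \<beta> to \<beta>+s. The
  moments then leave a 2F1 at 1, which Chu-Vandermonde evaluates to zero.\<close>

lemma hahn_poly_orthogonal_pochhammer:
  assumes "n \<le> N" and "\<alpha> > -1" and "\<beta> > -1" and "s < n"
  shows "(\<Sum>j\<le>N. hahn_weight \<alpha> \<beta> N j * poly (hahn_poly \<alpha> \<beta> N n) (real j) *
    pochhammer (\<beta> + 1 + (real N - real j)) s) = 0"
proof -
  let ?c = "\<alpha> + (\<beta> + real s) + 2"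
  let ?a = "real n + \<alpha> + \<beta> + 1"
  define d where "d k = pochhammer (- real n) k * pochhammer ?a k /
    (pochhammer (\<alpha> + 1) k * pochhammer (- real N) k * fact k)" for k
  \<comment> \<open>Both sides contain (\<beta>+1)_(N-j+s), split in two ways.\<close>
  have w: "hahn_weight \<alpha> \<beta> N j * pochhammer (\<beta> + 1 + (real N - real j)) s =
    pochhammer (\<beta> + 1) s * hahn_weight \<alpha> (\<beta> + real s) N j" if "j \<le> N" for j
    using pochhammer_product' [of "\<beta> + 1" "N - j" s] pochhammer_product' [of "\<beta> + 1" s "N - j"] that
    by (simp add: hahn_weight_def of_nat_diff add_ac mult_ac)
  have Q: "poly (hahn_poly \<alpha> \<beta> N n) (real j) = (\<Sum>k\<le>n. d k * pochhammer (- real j) k)" for j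
    unfolding poly_hahn_poly hyp3F2_def d_def by (simp add: mult_ac)
  have "(\<Sum>j\<le>N. hahn_weight \<alpha> \<beta> N j * poly (hahn_poly \<alpha> \<beta> N n) (real j) *
      pochhammer (\<beta> + 1 + (real N - real j)) s) =
    (\<Sum>j\<le>N. \<Sum>k\<le>n. pochhammer (\<beta> + 1) s * (d k * (hahn_weight \<alpha> (\<beta> + real s) N j * pochhammer (- real j) k)))"
  proof (rule sum.cong [OF refl])
    fix j assume "j \<in> {..N}"
    then have "hahn_weight \<alpha> \<beta> N j * pochhammer (\<beta> + 1 + (real N - real j)) s * poly (hahn_poly \<alpha> \<beta> N n) (real j) =
      pochhammer (\<beta> + 1) s * hahn_weight \<alpha> (\<beta> + real s) N j * (\<Sum>k\<le>n. d k * pochhammer (- real j) k)"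
      by (simp only: w Q atMost_iff)
    then show "hahn_weight \<alpha> \<beta> N j * poly (hahn_poly \<alpha> \<beta> N n) (real j) *
        pochhammer (\<beta> + 1 + (real N - real j)) s =
      (\<Sum>k\<le>n. pochhammer (\<beta> + 1) s * (d k * (hahn_weight \<alpha> (\<beta> + real s) N j * pochhammer (- real j) k)))"
      by (simp add: sum_distrib_left mult_ac)
  qed
  also have "\<dots> = pochhammer (\<beta> + 1) s *
    (\<Sum>k\<le>n. d k * (\<Sum>j\<le>N. hahn_weight \<alpha> (\<beta> + real s) N j * pochhammer (- real j) k))"
    by (subst sum.swap) (simp add: sum_distrib_left)
  \<comment> \<open>The moment cancels (\<alpha>+1)_k (-N)_k in the coefficients of the Hahn
    polynomial.\<close>
  also have "(\<Sum>k\<le>n. d k * (\<Sum>j\<le>N. hahn_weight \<alpha> (\<beta> + real s) N j * pochhammer (- real j) k)) =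
    (\<Sum>k\<le>n. pochhammer ?c N / fact N *
      (pochhammer ?a k * pochhammer (- real n) k / (of_nat (fact k) * pochhammer ?c k)))"
  proof (rule sum.cong [OF refl])
    fix k assume k: "k \<in> {..n}"
    have "pochhammer (\<alpha> + 1) k \<noteq> 0" "pochhammer (- real N) k \<noteq> 0"
      using assms k pochhammer_pos [of "\<alpha> + 1" k] by (auto simp: pochhammer_of_nat_eq_0_iff)
    moreover have "(\<Sum>j\<le>N. hahn_weight \<alpha> (\<beta> + real s) N j * pochhammer (- real j) k) =
      pochhammer (- real N) k * pochhammer (\<alpha> + 1) k * pochhammer ?c N / (pochhammer ?c k * fact N)"
      using assms by (intro sum_hahn_weight_pochhammer) auto
    ultimately show "d k * (\<Sum>j\<le>N. hahn_weight \<alpha> (\<beta> + real s) N j * pochhammer (- real j) k) =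
      pochhammer ?c N / fact N *
      (pochhammer ?a k * pochhammer (- real n) k / (of_nat (fact k) * pochhammer ?c k))"
      by (simp add: d_def mult_ac)
  qed
  also have "\<dots> = pochhammer ?c N / fact N * (pochhammer (?c - ?a) n / pochhammer ?c n)"
  proof -
    have "\<forall>i\<in>{0..<n}. ?c \<noteq> - of_nat i" using assms by auto
    from Vandermonde_pochhammer [OF this, of ?a] show ?thesis
      by (simp only: sum_distrib_left [symmetric] atLeast0AtMost)
  qed
  \<comment> \<open>Since n-1-s is a natural number below n, zero occurs among the n factors of the
    numerator.\<close>
  also have "?c - ?a = - real (n - 1 - s)" using assms by (simp add: of_nat_diff)
  also have "pochhammer (- real (n - 1 - s)) n = 0"
    using assms by (simp only: pochhammer_of_nat_eq_0_iff)
  finally show ?thesis by simp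
qed

text \<open>Triangular elimination from the top coefficient down. Low degree is expressed by
  vanishing coefficients, so that n = 0 forces the zero polynomial.\<close>

lemma poly_in_span:
  fixes P :: "nat \<Rightarrow> 'a::field poly"
  assumes "\<And>s. s < n \<Longrightarrow> degree (P s) \<le> s" and "\<And>s. s < n \<Longrightarrow> coeff (P s) s \<noteq> 0"
    and "\<And>i. i \<ge> n \<Longrightarrow> coeff p i = 0"
  obtains c where "p = (\<Sum>s<n. smult (c s) (P s))"
proof -
  have "\<exists>c. p = (\<Sum>s<n. smult (c s) (P s))"
    using assms
  proof (induction n arbitrary: p)
    case 0
    then have "p = 0" by (intro poly_eqI) simp
    then show ?case by simp
  next
    case (Suc n)
    define b where "b = coeff p n / coeff (P n) n"
    have "\<exists>c. p - smult b (P n) = (\<Sum>s<n. smult (c s) (P s))"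
    proof (rule Suc.IH)
      fix i assume "i \<ge> n"
      show "coeff (p - smult b (P n)) i = 0"
      proof (cases "i = n")
        case True
        then show ?thesis using Suc.prems(2) [of n] by (simp add: b_def)
      next
        case False
        then have "i > n" using \<open>i \<ge> n\<close> by simp
        then show ?thesis using Suc.prems(1) [of n] Suc.prems(3) [of i] by (simp add: coeff_eq_0)
      qed
    qed (use Suc.prems in auto)
    then obtain c where c: "p - smult b (P n) = (\<Sum>s<n. smult (c s) (P s))" ..
    have "p = (\<Sum>s<Suc n. smult ((c(n := b)) s) (P s))"
      using c by (simp add: algebra_simps)
    then show ?case by blast
  qed
  with that show ?thesis by blast
qed

lemma hahn_poly_orthogonal:
  assumes "n \<le> N" and "\<alpha> > -1" and "\<beta> > -1" and p: "\<And>i. i \<ge> n \<Longrightarrow> coeff p i = 0"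
  shows "(\<Sum>j\<le>N. hahn_weight \<alpha> \<beta> N j * poly (hahn_poly \<alpha> \<beta> N n) (real j) * poly p (real j)) = 0"
proof -
  \<comment> \<open>As a polynomial in x this is (\<beta>+1+N-x)_s, the test function already
    handled.\<close>
  define R where "R s = pcompose (pochhammer [:0, -1:] s) [:- (\<beta> + 1 + real N), 1:]" for s
  have deg: "degree (R s) \<le> s" for s
    using degree_pochhammer_poly [of s] by (simp add: R_def degree_pcompose)
  have "coeff (R s) s \<noteq> 0" for s
  proof -
    have "degree (pochhammer [:0, -1 :: real:] s) = s"
      using degree_pochhammer_poly [of s] coeff_pochhammer_poly [of s]
      by (intro antisym le_degree) auto
    then have "coeff (R s) s = lead_coeff (R s)" by (simp add: R_def degree_pcompose)
    also have "\<dots> = (-1) ^ s"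
      using \<open>degree (pochhammer [:0, -1 :: real:] s) = s\<close> coeff_pochhammer_poly [of s]
      by (simp add: R_def lead_coeff_comp)
    finally show ?thesis by simp
  qed
  with deg obtain c where c: "p = (\<Sum>s<n. smult (c s) (R s))"
    using p by (rule poly_in_span [of n R p])
  have R: "poly (R s) x = pochhammer (\<beta> + 1 + (real N - x)) s" for s x
    by (simp add: R_def poly_pcompose pochhammer_prod poly_prod algebra_simps)
  have "(\<Sum>j\<le>N. hahn_weight \<alpha> \<beta> N j * poly (hahn_poly \<alpha> \<beta> N n) (real j) * poly p (real j)) =
    (\<Sum>s<n. c s * (\<Sum>j\<le>N. hahn_weight \<alpha> \<beta> N j * poly (hahn_poly \<alpha> \<beta> N n) (real j) *
      pochhammer (\<beta> + 1 + (real N - real j)) s))"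
    unfolding c poly_sum poly_smult R sum_distrib_left
    by (subst sum.swap) (simp add: mult_ac)
  also have "\<dots> = 0"
    using hahn_poly_orthogonal_pochhammer [OF assms(1-3)] by simp
  finally show ?thesis .
qed

text \<open>Uniqueness of orthogonal polynomials: removing the right multiple of
  \<open>hahn_poly\<close> from the polynomial factor \<open>q\<close> leaves a remainder of lower
  degree that is orthogonal to itself, so it vanishes on the grid. Equality at grid points is all
  that is claimed.\<close>

lemma hahn_rodrigues:
  assumes n: "1 \<le> n" "n \<le> N" and \<alpha>: "\<alpha> > -1" and \<beta>: "\<beta> > -1"
  obtains K where "K \<noteq> 0"
    and "\<And>j. j \<le> N \<Longrightarrow> hahn_weight \<alpha> \<beta> N j * poly (hahn_poly \<alpha> \<beta> N n) (real j) =
      K * coeff ([:1, -1:] ^ n * hahn_gen (\<alpha> + real n) (\<beta> + real n) (N - n)) j"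
proof -
  let ?w = "hahn_weight \<alpha> \<beta> N" and ?Q = "hahn_poly \<alpha> \<beta> N n"
    and ?V = "hahn_gen (\<alpha> + real n) (\<beta> + real n) (N - n)"
  let ?U = "[:1, -1:] ^ n * ?V"
  obtain q where q: "degree q \<le> n"
    and Uq: "\<And>j. j \<le> N \<Longrightarrow> coeff ?U j = ?w j * poly q (real j)"
    using one_minus_X_power_mult_hahn_gen [OF \<alpha> \<beta>, of n "N - n"] n by auto
  have degV: "degree ?V \<le> N - n"
    by (rule degree_le) (simp add: coeff_hahn_gen)
  \<comment> \<open>Chosen to cancel the coefficient at index n in \<open>r\<close>.\<close>
  define b where "b = coeff q n / coeff ?Q n"
  define r where "r = q - smult b ?Q"
  have r0: "coeff r i = 0" if "i \<ge> n" for i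
  proof (cases "i = n")
    case True
    then show ?thesis using coeff_hahn_poly_nonzero [OF n \<alpha> \<beta>] by (simp add: r_def b_def)
  next
    case False
    then have "i > n" using that by simp
    then show ?thesis
      using q degree_hahn_poly_le [of \<alpha> \<beta> N n] by (simp add: r_def coeff_eq_0)
  qed
  \<comment> \<open>The first sum vanishes by summation by parts and the second by orthogonality, as
    \<open>r\<close> has degree below n.\<close>
  have "(\<Sum>j\<le>N. ?w j * (poly r (real j))\<^sup>2) =
    (\<Sum>j\<le>N. coeff ?U j * poly r (real j)) - b * (\<Sum>j\<le>N. ?w j * poly ?Q (real j) * poly r (real j))"
    by (simp add: Uq sum_distrib_left flip: sum_subtractf)
       (simp add: r_def power2_eq_square algebra_simps)
  also have "(\<Sum>j\<le>N. coeff ?U j * poly r (real j)) = 0"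
  proof -
    have "degree r \<le> n" using r0 by (intro degree_le) simp
    from sum_coeff_one_minus_X_power_mult [OF degV this] show ?thesis
      using n r0 [of n] by simp
  qed
  also have "(\<Sum>j\<le>N. ?w j * poly ?Q (real j) * poly r (real j)) = 0"
    using r0 by (rule hahn_poly_orthogonal [OF n(2) \<alpha> \<beta>])
  finally have "(\<Sum>j\<le>N. ?w j * (poly r (real j))\<^sup>2) = 0" by simp
  then have zeros: "poly r (real j) = 0" if "j \<le> N" for j
    using that hahn_weight_pos [OF \<alpha> \<beta>, of N]
    by (subst (asm) sum_nonneg_eq_0_iff) (auto simp: less_imp_le less_imp_neq [symmetric])
  have w: "coeff ?U j = b * (?w j * poly ?Q (real j))" if "j \<le> N" for j
    using zeros [OF that] Uq [OF that] by (simp add: r_def)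
  \<comment> \<open>At z = 0 the factor (1-z)^n is 1, so the constant coefficient is a weight, which
    is positive.\<close>
  have "b \<noteq> 0"
  proof
    assume "b = 0"
    then have "coeff ?U 0 = 0" using w by simp
    then have "coeff ?V 0 = 0" by (simp add: coeff_mult coeff_0_power)
    then show False
      using hahn_weight_pos [of "\<alpha> + real n" "\<beta> + real n" "N - n" 0] \<alpha> \<beta>
      by (simp add: coeff_hahn_gen)
  qed
  with w show ?thesis
    by (intro that [of "1 / b"]) auto
qed

text \<open>The Rodrigues constant \<open>K\<close> occurs once in the weighted polynomial and once
  in the norm, so it cancels together with the leading coefficient and n!. What remains is division
  by (-1)^n V(1).\<close>

lemma hahn_normalized_weight:
  assumes n: "1 \<le> n" "n \<le> N" and \<alpha>: "\<alpha> > -1" and \<beta>: "\<beta> > -1" and j: "j \<le> N"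
  shows "lead_coeff (hahn_poly \<alpha> \<beta> N n) * fact n / hahn_norm \<alpha> \<beta> N n *
      (hahn_weight \<alpha> \<beta> N j * poly (hahn_poly \<alpha> \<beta> N n) (real j)) =
    (-1) ^ n * fact (N - n) / pochhammer (2 * real n + \<alpha> + \<beta> + 2) (N - n) *
      coeff ([:1, -1:] ^ n * hahn_gen (\<alpha> + real n) (\<beta> + real n) (N - n)) j"
proof -
  let ?w = "hahn_weight \<alpha> \<beta> N" and ?Q = "hahn_poly \<alpha> \<beta> N n"
    and ?V = "hahn_gen (\<alpha> + real n) (\<beta> + real n) (N - n)"
  let ?U = "[:1, -1:] ^ n * ?V"
  let ?c = "pochhammer (2 * real n + \<alpha> + \<beta> + 2) (N - n)"
  obtain K where K: "K \<noteq> 0"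
    and KU: "\<And>j. j \<le> N \<Longrightarrow> ?w j * poly ?Q (real j) = K * coeff ?U j"
    using hahn_rodrigues [OF n \<alpha> \<beta>] by blast
  have nz: "coeff ?Q n \<noteq> 0" by (rule coeff_hahn_poly_nonzero [OF n \<alpha> \<beta>])
  then have degQ: "degree ?Q = n"
    using degree_hahn_poly_le [of \<alpha> \<beta> N n] by (intro antisym le_degree)
  have degV: "degree ?V \<le> N - n"
    by (rule degree_le) (simp add: coeff_hahn_gen)
  have c: "?c > 0" using \<alpha> \<beta> n by (intro pochhammer_pos) simp
  \<comment> \<open>Only one of the two factors of the square is rewritten by the Rodrigues formula;
    the other serves as the test polynomial.\<close>
  have "hahn_norm \<alpha> \<beta> N n = K * (\<Sum>j\<le>N. coeff ?U j * poly ?Q (real j))"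
    unfolding hahn_norm_def sum_distrib_left
    by (intro sum.cong refl) (simp add: power2_eq_square KU [symmetric] mult_ac)
  also have "(\<Sum>j\<le>N. coeff ?U j * poly ?Q (real j)) =
    (-1) ^ n * fact n * coeff ?Q n * (\<Sum>j\<le>N - n. coeff ?V j)"
    using sum_coeff_one_minus_X_power_mult [OF degV, of ?Q n] degQ n by simp
  also have "(\<Sum>j\<le>N - n. coeff ?V j) = ?c / fact (N - n)"
    using sum_hahn_weight [of "\<alpha> + real n" "\<beta> + real n" "N - n"] by (simp add: coeff_hahn_gen add_ac)
  finally have h: "hahn_norm \<alpha> \<beta> N n = K * ((-1) ^ n * fact n * coeff ?Q n * (?c / fact (N - n)))" .
  have m1: "(-1) ^ n * (-1) ^ n = (1::real)" by (simp flip: power_add)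
  show ?thesis
    using K nz c m1 unfolding h degQ KU [OF j]
    by (simp add: field_simps)
qed

section \<open>Fractional sums and the two hypergeometric sums\<close>

text \<open>The backward difference lowers the order by one, termwise by
  \<open>pochhammer_fact_diff\<close>. Summability at \<open>y\<close> and at
  \<open>y - \<delta>\<close> yields summability of the lower order. The powers of \<delta> are left
  out of the series here.\<close>

lemma frac_series_step:
  assumes "\<And>y. frac_summable \<delta> \<mu> f y"
  shows "frac_summable \<delta> (\<mu> - 1) f y"
    and "(\<Sum>k. pochhammer (\<mu> - 1) k / fact k * f (y - real k * \<delta>)) =
      (\<Sum>k. pochhammer \<mu> k / fact k * f (y - real k * \<delta>)) -
      (\<Sum>k. pochhammer \<mu> k / fact k * f (y - \<delta> - real k * \<delta>))"
proof -
  let ?a = "\<lambda>y k. pochhammer \<mu> k / fact k * f (y - real k * \<delta>)"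
  let ?b = "\<lambda>k. pochhammer (\<mu> - 1) k / fact k * f (y - real k * \<delta>)"
  have s: "summable (?a y)" for y
    using assms unfolding frac_summable_def .
  have "?b (Suc k) = ?a y (Suc k) - ?a (y - \<delta>) k" for k
  proof -
    have "f (y - \<delta> - real k * \<delta>) = f (y - real (Suc k) * \<delta>)"
      by (simp add: algebra_simps)
    then show ?thesis
      using pochhammer_fact_diff [of "\<mu> - 1" k]
      by (simp only: diff_add_cancel left_diff_distrib [symmetric])
  qed
  moreover have "(\<lambda>k. ?a y (Suc k)) sums (suminf (?a y) - ?a y 0)"
    using summable_sums [OF s [of y]] sums_Suc_iff [where f = "?a y" and s = "suminf (?a y) - ?a y 0"]
    by (simp only: diff_add_cancel)
  ultimately have "(\<lambda>k. ?b (Suc k)) sums (suminf (?a y) - ?a y 0 - suminf (?a (y - \<delta>)))"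
    using sums_diff [OF _ summable_sums [OF s [of "y - \<delta>"]]] by presburger
  \<comment> \<open>The terms at k = 0 are both \<open>f y\<close>, so restoring the first term
    leaves the plain difference.\<close>
  from sums_Suc [where f = ?b, OF this] have "?b sums (suminf (?a y) - suminf (?a (y - \<delta>)))"
    by simp
  then show "frac_summable \<delta> (\<mu> - 1) f y" and "suminf ?b = suminf (?a y) - suminf (?a (y - \<delta>))"
    by (auto simp: frac_summable_def sums_iff)
qed

text \<open>All n factors 1-z are moved onto the fractional series. Summability is carried in the
  same induction because each further step needs it at the lowered order.\<close>

lemma sum_coeff_frac_series:
  fixes V :: "real poly"
  assumes V: "degree V \<le> M" and "\<And>y. frac_summable \<delta> \<mu> f y"
  shows "(\<forall>y. frac_summable \<delta> (\<mu> - of_nat n) f y) \<and>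
    (\<Sum>j\<le>M + n. of_real (coeff ([:1, -1:] ^ n * V) j) *
      (\<Sum>k. pochhammer \<mu> k / fact k * f (x + real j * \<delta> - real k * \<delta>))) =
    (-1) ^ n * (\<Sum>l\<le>M. of_real (coeff V l) *
      (\<Sum>k. pochhammer (\<mu> - of_nat n) k / fact k * f (x + real (l + n) * \<delta> - real k * \<delta>)))"
  using assms(2)
proof (induction n arbitrary: \<mu> x)
  case 0
  then show ?case by simp
next
  case (Suc n)
  define G where "G \<mu> y = (\<Sum>k. pochhammer \<mu> k / fact k * f (y - real k * \<delta>))" for \<mu> y
  have deg: "degree ([:1, -1:] ^ n * V) \<le> M + n"
    using V degree_mult_le [of "[:1, -1:] ^ n" V] degree_power_le [of "[:1, -1 :: real:]" n] by simp
  have step: "G (\<mu> - 1) y = G \<mu> y - G \<mu> (y - \<delta>)" for y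
    unfolding G_def by (rule frac_series_step(2) [OF Suc.prems])
  have IH: "(\<forall>y. frac_summable \<delta> (\<mu> - 1 - of_nat n) f y) \<and>
    (\<Sum>j\<le>M + n. of_real (coeff ([:1, -1:] ^ n * V) j) * G (\<mu> - 1) (x + \<delta> + real j * \<delta>)) =
    (-1) ^ n * (\<Sum>l\<le>M. of_real (coeff V l) * G (\<mu> - 1 - of_nat n) (x + \<delta> + real (l + n) * \<delta>))"
    unfolding G_def by (rule Suc.IH [OF frac_series_step(1) [OF Suc.prems]])
  have "(\<Sum>j\<le>M + Suc n. of_real (coeff ([:1, -1:] ^ Suc n * V) j) * G \<mu> (x + real j * \<delta>)) =
    (\<Sum>j\<le>M + n. of_real (coeff ([:1, -1:] ^ n * V) j) *
      (G \<mu> (x + real j * \<delta>) - G \<mu> (x + real (Suc j) * \<delta>)))"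
    using sum_coeff_one_minus_X_mult [OF deg, of "\<lambda>j. G \<mu> (x + real j * \<delta>)"]
    unfolding power_Suc mult.assoc add_Suc_right .
  \<comment> \<open>A value minus its successor is minus a backward difference at the successor:
    each factor 1-z costs a sign and a shift by \<delta>.\<close>
  also have "\<dots> = - (\<Sum>j\<le>M + n. of_real (coeff ([:1, -1:] ^ n * V) j) * G (\<mu> - 1) (x + \<delta> + real j * \<delta>))"
    unfolding step by (simp add: algebra_simps sum_subtractf)
  also have "\<dots> = (-1) ^ Suc n * (\<Sum>l\<le>M. of_real (coeff V l) * G (\<mu> - 1 - of_nat n) (x + \<delta> + real (l + n) * \<delta>))"
    using IH by simp
  also have "\<dots> = (-1) ^ Suc n * (\<Sum>l\<le>M. of_real (coeff V l) * G (\<mu> - of_nat (Suc n)) (x + real (l + Suc n) * \<delta>))"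
    by (simp add: algebra_simps)
  finally show ?case
    using IH unfolding G_def by (simp add: algebra_simps)
qed

section \<open>Conversion of the weighted sums to hypergeometric form\<close>

lemma hahn_weight_reflect: "i \<le> M \<Longrightarrow> hahn_weight \<alpha> \<beta> M (M - i) = hahn_weight \<beta> \<alpha> M i"
  by (simp add: hahn_weight_def mult_ac)

lemma pochhammer_minus_nonzero:
  fixes \<beta> :: real
  assumes "\<beta> > -1" and "l \<le> M"
  shows "pochhammer (- \<beta> - real M) l \<noteq> 0"
  using assms by (auto simp: pochhammer_eq_0_iff)

text \<open>Reflecting both (\<beta>+1)_(M-l) and (M-l)! turns the weight into a hypergeometric
  term; the two signs cancel.\<close>

lemma hahn_weight_hypergeometric:
  assumes "\<beta> > -1" and "l \<le> M"
  shows "fact M * hahn_weight \<alpha> \<beta> M l = pochhammer (\<beta> + 1) M *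
    (pochhammer (- real M) l * pochhammer (\<alpha> + 1) l / (pochhammer (- \<beta> - real M) l * fact l))"
proof -
  have sq: "((-1) ^ l)\<^sup>2 = (1::real)" by (simp flip: power_mult)
  have 1: "pochhammer (\<beta> + 1) (M - l) * pochhammer (- \<beta> - real M) l = (-1) ^ l * pochhammer (\<beta> + 1) M"
    using pochhammer_reflect [OF assms(2), of "\<beta> + 1"] by (simp add: algebra_simps)
  have 2: "fact (M - l) * pochhammer (- real M) l = (-1) ^ l * fact M"
    using pochhammer_reflect [OF assms(2), of "1 :: real"] by (simp add: pochhammer_fact)
  have 1: "pochhammer (\<beta> + 1) (M - l) = (-1) ^ l * pochhammer (\<beta> + 1) M / pochhammer (- \<beta> - real M) l"
    using 1 pochhammer_minus_nonzero [OF assms] by (simp add: eq_divide_eq)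
  have 2: "pochhammer (- real M) l = (-1) ^ l * fact M / fact (M - l)"
    using 2 by (simp add: eq_divide_eq mult.commute)
  show ?thesis
    using sq unfolding hahn_weight_def 1 2 by (simp add: power2_eq_square mult_ac)
qed

text \<open>The same double reflection, with b = -\<nu> and b = 1.\<close>

lemma pochhammer_div_fact_reflect:
  fixes \<nu> :: "'a::field_char_0"
  assumes "i \<le> K" and nz: "pochhammer (\<nu> - of_nat K + 1) i \<noteq> 0"
  shows "pochhammer (- \<nu>) (K - i) / fact (K - i) =
    pochhammer (- \<nu>) K / fact K * (pochhammer (- of_nat K) i / pochhammer (\<nu> - of_nat K + 1) i)"
proof -
  have 1: "pochhammer (- \<nu>) (K - i) * pochhammer (\<nu> - of_nat K + 1) i = (-1) ^ i * pochhammer (- \<nu>) K"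
    using pochhammer_reflect [OF assms(1), of "- \<nu>"] by (simp add: algebra_simps)
  have 2: "fact (K - i) * pochhammer (- of_nat K) i = (-1) ^ i * (fact K :: 'a)"
    using pochhammer_reflect [OF assms(1), of "1 :: 'a"] by (simp add: pochhammer_fact)
  have 1: "pochhammer (- \<nu>) (K - i) = (-1) ^ i * pochhammer (- \<nu>) K / pochhammer (\<nu> - of_nat K + 1) i"
    using 1 nz by (simp add: eq_divide_eq)
  have 2: "pochhammer (- of_nat K) i = (-1) ^ i * (fact K :: 'a) / fact (K - i)"
    using 2 by (simp add: eq_divide_eq mult.commute)
  show ?thesis unfolding 1 2 by (simp add: mult_ac)
qed

text \<open>Termwise: the weight becomes a hypergeometric term, while (-\<nu>)_(m+n+l) and (m+n+l)!
  split after their first m+n factors.\<close>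

lemma backward_sum:
  fixes \<nu> :: complex
  assumes "n \<le> N" and "\<beta> > -1"
  shows "of_real (pochhammer (\<beta> + real n + 1) (N - n)) * (pochhammer (- \<nu>) (m + n) / fact (m + n) *
      hyp3F2 (N - n)
        (of_nat n - of_nat N) (of_nat n + of_real \<alpha> + 1) (of_nat m + of_nat n - \<nu>)
        (- of_nat N - of_real \<beta>) (of_nat m + of_nat n + 1)) =
    fact (N - n) * (\<Sum>l\<le>N - n. of_real (hahn_weight (\<alpha> + real n) (\<beta> + real n) (N - n) l) *
      (pochhammer (- \<nu>) (m + n + l) / fact (m + n + l)))"
  unfolding hyp3F2_def sum_distrib_left
proof (rule sum.cong [OF refl])
  let ?M = "N - n"
  fix l assume "l \<in> {..?M}"
  then have l: "l \<le> ?M" by simp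
  have "fact ?M * hahn_weight (\<alpha> + real n) (\<beta> + real n) ?M l = pochhammer (\<beta> + real n + 1) ?M *
    (pochhammer (real n - real N) l * pochhammer (real n + \<alpha> + 1) l / (pochhammer (- real N - \<beta>) l * fact l))"
    using hahn_weight_hypergeometric [of "\<beta> + real n" l ?M "\<alpha> + real n"] assms l
    by (simp add: of_nat_diff add_ac minus_diff_commute)
  then have "complex_of_real (fact ?M * hahn_weight (\<alpha> + real n) (\<beta> + real n) ?M l) =
    of_real (pochhammer (\<beta> + real n + 1) ?M *
    (pochhammer (real n - real N) l * pochhammer (real n + \<alpha> + 1) l / (pochhammer (- real N - \<beta>) l * fact l)))"
    by (rule arg_cong)
  then have v: "fact ?M * of_real (hahn_weight (\<alpha> + real n) (\<beta> + real n) ?M l) =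
    of_real (pochhammer (\<beta> + real n + 1) ?M) *
    (pochhammer (of_nat n - of_nat N) l * pochhammer (of_nat n + of_real \<alpha> + 1) l /
      (pochhammer (- of_nat N - of_real \<beta>) l * fact l) :: complex)"
    by (simp flip: pochhammer_of_real)
  have f: "(fact (m + n + l) :: complex) = fact (m + n) * pochhammer (of_nat m + of_nat n + 1) l"
    using pochhammer_product' [of "1 :: complex" "m + n" l] by (simp add: pochhammer_fact add_ac)
  have p: "pochhammer (- \<nu>) (m + n + l) = pochhammer (- \<nu>) (m + n) * pochhammer (of_nat m + of_nat n - \<nu>) l"
    using pochhammer_product' [of "- \<nu>" "m + n" l] by (simp add: algebra_simps)
  show "of_real (pochhammer (\<beta> + real n + 1) ?M) * (pochhammer (- \<nu>) (m + n) / fact (m + n) *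
      (pochhammer (of_nat n - of_nat N) l * pochhammer (of_nat n + of_real \<alpha> + 1) l *
        pochhammer (of_nat m + of_nat n - \<nu>) l /
        (pochhammer (- of_nat N - of_real \<beta>) l * pochhammer (of_nat m + of_nat n + 1) l * fact l))) =
    fact ?M * (of_real (hahn_weight (\<alpha> + real n) (\<beta> + real n) ?M l) *
      (pochhammer (- \<nu>) (m + n + l) / fact (m + n + l)))"
    unfolding mult.assoc [of "fact ?M", symmetric] v unfolding f p by (simp add: mult_ac)
qed

text \<open>Here the series coefficients have decreasing index, so they are reflected too. The bound
  \<open>min (N - n) (N - m)\<close> keeps both reflections in range.\<close>

lemma forward_sum_generic:
  fixes \<nu> :: complex
  assumes "n \<le> N" and "m \<le> N" and "\<alpha> > -1" and "\<nu> \<notin> \<nat>"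
  shows "of_real (pochhammer (\<alpha> + real n + 1) (N - n)) * forward_term \<alpha> \<beta> N n m \<nu> =
    fact (N - n) * (\<Sum>i\<le>min (N - n) (N - m).
      of_real (hahn_weight (\<beta> + real n) (\<alpha> + real n) (N - n) i) *
      (pochhammer (- \<nu>) (N - m - i) / fact (N - m - i)))"
  unfolding forward_term_def hyp3F2_def sum_distrib_left
proof (rule sum.cong [OF refl])
  let ?M = "N - n" and ?K = "N - m"
  fix i assume "i \<in> {..min ?M ?K}"
  then have i: "i \<le> ?M" "i \<le> ?K" by simp_all
  have "fact ?M * hahn_weight (\<beta> + real n) (\<alpha> + real n) ?M i = pochhammer (\<alpha> + real n + 1) ?M *
    (pochhammer (real n - real N) i * pochhammer (\<beta> + real n + 1) i / (pochhammer (- \<alpha> - real N) i * fact i))"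
    using hahn_weight_hypergeometric [of "\<alpha> + real n" i ?M "\<beta> + real n"] assms i
    by (simp add: of_nat_diff add_ac minus_diff_commute)
  then have "complex_of_real (fact ?M * hahn_weight (\<beta> + real n) (\<alpha> + real n) ?M i) =
    of_real (pochhammer (\<alpha> + real n + 1) ?M *
    (pochhammer (real n - real N) i * pochhammer (\<beta> + real n + 1) i / (pochhammer (- \<alpha> - real N) i * fact i)))"
    by (rule arg_cong)
  then have v: "fact ?M * of_real (hahn_weight (\<beta> + real n) (\<alpha> + real n) ?M i) =
    of_real (pochhammer (\<alpha> + real n + 1) ?M) *
    (pochhammer (of_nat n - of_nat N) i * pochhammer (of_real \<beta> + of_nat n + 1) i /
      (pochhammer (- of_real \<alpha> - of_nat N) i * fact i) :: complex)"
    by (simp flip: pochhammer_of_real)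
  \<comment> \<open>A zero factor would make \<nu> equal to K-1-k with k < i, a natural number as i
    is at most K.\<close>
  have "pochhammer (\<nu> - of_nat ?K + 1) i \<noteq> 0"
  proof
    assume "pochhammer (\<nu> - of_nat ?K + 1) i = 0"
    then obtain k where k: "k < i" and "\<nu> - of_nat ?K + 1 = - of_nat k"
      unfolding pochhammer_eq_0_iff by blast
    then have "\<nu> = of_nat ?K - of_nat (k + 1)" by (simp add: algebra_simps)
    also have "\<dots> = of_nat (?K - (k + 1))" using k i by (intro of_nat_diff [symmetric]) simp
    finally show False using assms(4) by simp
  qed
  from pochhammer_div_fact_reflect [OF i(2) this]
  have p: "pochhammer (- \<nu>) (?K - i) / fact (?K - i) = pochhammer (- \<nu>) ?K / fact ?K *
    (pochhammer (of_nat m - of_nat N) i / pochhammer (\<nu> - of_nat N + of_nat m + 1) i)"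
    using assms(2) by (simp add: of_nat_diff algebra_simps)
  show "of_real (pochhammer (\<alpha> + real n + 1) ?M) * (pochhammer (- \<nu>) ?K / fact ?K *
      (pochhammer (of_nat n - of_nat N) i * pochhammer (of_real \<beta> + of_nat n + 1) i *
        pochhammer (of_nat m - of_nat N) i /
        (pochhammer (- of_real \<alpha> - of_nat N) i * pochhammer (\<nu> - of_nat N + of_nat m + 1) i * fact i))) =
    fact ?M * (of_real (hahn_weight (\<beta> + real n) (\<alpha> + real n) ?M i) *
      (pochhammer (- \<nu>) (?K - i) / fact (?K - i)))"
    unfolding mult.assoc [of "fact ?M", symmetric] v p by (simp add: mult_ac)
qed

text \<open>The naturals have no accumulation point, so the limit in \<open>forward_coeff\<close>
  only sees arguments where \<open>forward_sum_generic\<close> applies.\<close>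

lemma eventually_not_Nats: "eventually (\<lambda>z::'a::real_normed_algebra_1. z \<notin> \<nat>) (at a)"
proof -
  have "closed ((\<nat> :: 'a set) - {a})"
  proof -
    have "(\<nat> :: 'a set) - {a} = of_nat ` {k. of_nat k \<noteq> a}" by (auto simp: Nats_def)
    then show ?thesis by (simp add: closed_of_nat_image)
  qed
  then have "open (- (\<nat> - {a}))" by (simp only: open_closed double_complement)
  then show ?thesis unfolding eventually_at_topological by blast
qed

text \<open>The right side is a polynomial in \<nu>. It therefore provides the limit by which
  \<open>forward_coeff\<close> is defined at the natural numbers.\<close>

lemma forward_sum:
  fixes \<nu> :: complex
  assumes "n \<le> N" and "m \<le> N" and "\<alpha> > -1"
  shows "of_real (pochhammer (\<alpha> + real n + 1) (N - n)) * forward_coeff \<alpha> \<beta> N n m \<nu> =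
    fact (N - n) * (\<Sum>i\<le>min (N - n) (N - m).
      of_real (hahn_weight (\<beta> + real n) (\<alpha> + real n) (N - n) i) *
      (pochhammer (- \<nu>) (N - m - i) / fact (N - m - i)))"
proof (cases "\<nu> \<in> \<nat>")
  case False
  then show ?thesis using forward_sum_generic [OF assms] by (simp add: forward_coeff_def)
next
  case True
  define c where "c = complex_of_real (pochhammer (\<alpha> + real n + 1) (N - n))"
  \<comment> \<open>The continuous extension of \<open>forward_term\<close> across the natural
    numbers.\<close>
  define g where "g \<nu> = fact (N - n) * (\<Sum>i\<le>min (N - n) (N - m).
      of_real (hahn_weight (\<beta> + real n) (\<alpha> + real n) (N - n) i) *
      (pochhammer (- \<nu>) (N - m - i) / fact (N - m - i))) / c" for \<nu> :: complex
  have "pochhammer (\<alpha> + real n + 1) (N - n) > 0"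
    using assms by (intro pochhammer_pos) simp
  then have c: "c \<noteq> 0" unfolding c_def by simp
  have eq: "forward_term \<alpha> \<beta> N n m \<nu> = g \<nu>" if "\<nu> \<notin> \<nat>" for \<nu>
    using forward_sum_generic [OF assms that, of \<beta>] c unfolding g_def c_def by (simp add: eq_divide_eq mult.commute)
  have "isCont g \<nu>"
    unfolding g_def pochhammer_prod using c by (intro continuous_intros) auto
  then have "(g \<longlongrightarrow> g \<nu>) (at \<nu>)" by (simp add: isCont_def)
  moreover have "eventually (\<lambda>z. g z = forward_term \<alpha> \<beta> N n m z) (at \<nu>)"
    using eventually_not_Nats by eventually_elim (simp add: eq)
  ultimately have "(forward_term \<alpha> \<beta> N n m \<longlongrightarrow> g \<nu>) (at \<nu>)"
    by (rule Lim_transform_eventually)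
  then have "Lim (at \<nu>) (forward_term \<alpha> \<beta> N n m) = g \<nu>"
    by (intro tendsto_Lim) auto
  then show ?thesis
    using True c unfolding forward_coeff_def c_def [symmetric] by (simp add: g_def)
qed

section \<open>Reduction to series of order -\<nu> and assembly of the closed form\<close>

lemma Gamma_ratio_eq_pochhammer:
  fixes z :: real
  assumes "z > 0" and "n \<le> N"
  shows "Gamma (z + real N - real n) / Gamma z = pochhammer z (N - n)"
  using pochhammer_Gamma [of z "N - n"] assms by (auto simp: of_nat_diff algebra_simps nonpos_Ints_def)

text \<open>The Rodrigues form of the weights meets summation by parts; the two signs (-1)^n cancel.
  Up to the power of \<delta>, the result is an average of series of order -\<nu> with weights
  summing to 1.\<close>

lemma hahn_difference_eq_sum:
  assumes n: "1 \<le> n" "n \<le> N" and \<alpha>: "\<alpha> > -1" and \<beta>: "\<beta> > -1" and \<delta>: "\<delta> > 0"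
    and f: "\<And>y. frac_summable \<delta> (of_nat n - \<nu>) f y"
  shows "frac_summable \<delta> (- \<nu>) f y"
    and "hahn_difference \<alpha> \<beta> N n \<delta> \<nu> f x = 1 / of_real \<delta> powr \<nu> *
      of_real (fact (N - n) / pochhammer (2 * real n + \<alpha> + \<beta> + 2) (N - n)) *
      (\<Sum>l\<le>N - n. of_real (hahn_weight (\<alpha> + real n) (\<beta> + real n) (N - n) l) *
        (\<Sum>k. pochhammer (- \<nu>) k / fact k * f (x + real (l + n) * \<delta> - real k * \<delta>)))"
proof -
  let ?M = "N - n"
  let ?V = "hahn_gen (\<alpha> + real n) (\<beta> + real n) ?M"
  define A where "A = fact ?M / pochhammer (2 * real n + \<alpha> + \<beta> + 2) ?M"
  define G where "G \<mu> y = (\<Sum>k. pochhammer \<mu> k / fact k * f (y - real k * \<delta>))" for \<mu> y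
  have degV: "degree ?V \<le> ?M"
    by (rule degree_le) (simp add: coeff_hahn_gen)
  have *: "of_nat n - \<nu> - of_nat n = - \<nu>" by simp
  note sumG = sum_coeff_frac_series [OF degV f, of n, unfolded *]
  from sumG show "frac_summable \<delta> (- \<nu>) f y" by blast
  have U: "(\<Sum>j\<le>N. of_real (coeff ([:1, -1:] ^ n * ?V) j) * G (of_nat n - \<nu>) (x + real j * \<delta>)) =
    (-1) ^ n * (\<Sum>l\<le>?M. of_real (hahn_weight (\<alpha> + real n) (\<beta> + real n) ?M l) *
      G (- \<nu>) (x + real (l + n) * \<delta>))"
    using conjunct2 [OF sumG, of x] n unfolding G_def by (simp add: coeff_hahn_gen)
  have powr: "of_real (1 / \<delta> ^ n) * complex_of_real \<delta> powr (of_nat n - \<nu>) = 1 / of_real \<delta> powr \<nu>"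
    using \<delta> by (simp add: powr_diff powr_nat')
  define C where "C = lead_coeff (hahn_poly \<alpha> \<beta> N n) * fact n / hahn_norm \<alpha> \<beta> N n"
  have w: "C * (hahn_weight \<alpha> \<beta> N j * poly (hahn_poly \<alpha> \<beta> N n) (real j)) =
    (-1) ^ n * A * coeff ([:1, -1:] ^ n * ?V) j" if "j \<le> N" for j
    using hahn_normalized_weight [OF n \<alpha> \<beta> that] by (simp add: C_def A_def)
  have "hahn_difference \<alpha> \<beta> N n \<delta> \<nu> f x =
    of_real (C * (1 / \<delta> ^ n)) *
    (\<Sum>j\<le>N. of_real \<delta> powr (of_nat n - \<nu>) * G (of_nat n - \<nu>) (x + real j * \<delta>) *
      of_real (hahn_weight \<alpha> \<beta> N j * poly (hahn_poly \<alpha> \<beta> N n) (real j)))"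
    unfolding hahn_difference_def approx_deriv_def frac_sum_def G_def C_def ..
  also have "\<dots> = (of_real (1 / \<delta> ^ n) * of_real \<delta> powr (of_nat n - \<nu>)) *
    (\<Sum>j\<le>N. of_real (C * (hahn_weight \<alpha> \<beta> N j * poly (hahn_poly \<alpha> \<beta> N n) (real j))) *
      G (of_nat n - \<nu>) (x + real j * \<delta>))"
    by (simp add: sum_distrib_left mult_ac)
  also have "(\<Sum>j\<le>N. of_real (C * (hahn_weight \<alpha> \<beta> N j * poly (hahn_poly \<alpha> \<beta> N n) (real j))) *
      G (of_nat n - \<nu>) (x + real j * \<delta>)) =
    (\<Sum>j\<le>N. of_real ((-1) ^ n * A * coeff ([:1, -1:] ^ n * ?V) j) *
      G (of_nat n - \<nu>) (x + real j * \<delta>))"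
    by (intro sum.cong refl) (simp only: w atMost_iff)
  also have "\<dots> = (-1) ^ n * of_real A *
    (\<Sum>j\<le>N. of_real (coeff ([:1, -1:] ^ n * ?V) j) * G (of_nat n - \<nu>) (x + real j * \<delta>))"
    by (simp add: sum_distrib_left mult_ac)
  also have "\<dots> = ((-1) ^ n * (-1) ^ n) * of_real A *
    (\<Sum>l\<le>?M. of_real (hahn_weight (\<alpha> + real n) (\<beta> + real n) ?M l) *
      G (- \<nu>) (x + real (l + n) * \<delta>))"
    unfolding U by (simp only: mult_ac)
  also have "(-1) ^ n * (-1) ^ n = (1 :: complex)" by (simp flip: power_add)
  finally show "hahn_difference \<alpha> \<beta> N n \<delta> \<nu> f x = 1 / of_real \<delta> powr \<nu> *
      of_real (fact (N - n) / pochhammer (2 * real n + \<alpha> + \<beta> + 2) (N - n)) *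
      (\<Sum>l\<le>N - n. of_real (hahn_weight (\<alpha> + real n) (\<beta> + real n) (N - n) l) *
        (\<Sum>k. pochhammer (- \<nu>) k / fact k * f (x + real (l + n) * \<delta> - real k * \<delta>)))"
    unfolding powr A_def [symmetric] G_def by (simp only: mult_1_left mult.assoc)
qed

text \<open>Index k = L - m reaches x + m\<delta> and k = L + m + 1 reaches x - (m+1)\<delta>; the
  point x itself belongs to the finite sum.\<close>

lemma frac_series_split:
  assumes "frac_summable \<delta> \<mu> f (x + real L * \<delta>)"
  shows "summable (\<lambda>m. pochhammer \<mu> (Suc m + L) / fact (Suc m + L) * f (x - real (Suc m) * \<delta>))"
    and "(\<Sum>k. pochhammer \<mu> k / fact k * f (x + real L * \<delta> - real k * \<delta>)) =
      (\<Sum>m. pochhammer \<mu> (Suc m + L) / fact (Suc m + L) * f (x - real (Suc m) * \<delta>)) +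
      (\<Sum>m\<le>L. pochhammer \<mu> (L - m) / fact (L - m) * f (x + real m * \<delta>))"
proof -
  let ?t = "\<lambda>k. pochhammer \<mu> k / fact k * f (x + real L * \<delta> - real k * \<delta>)"
  have s: "summable ?t" using assms unfolding frac_summable_def .
  have tail: "?t (m + Suc L) = pochhammer \<mu> (Suc m + L) / fact (Suc m + L) * f (x - real (Suc m) * \<delta>)" for m
  proof -
    have "x + real L * \<delta> - real (m + Suc L) * \<delta> = x - real (Suc m) * \<delta>" by (simp add: algebra_simps)
    then show ?thesis by (simp only: add_Suc_right add_Suc)
  qed
  show "summable (\<lambda>m. pochhammer \<mu> (Suc m + L) / fact (Suc m + L) * f (x - real (Suc m) * \<delta>))"
    using summable_ignore_initial_segment [OF s, of "Suc L"] unfolding tail .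
  have "(\<Sum>k<Suc L. ?t k) = (\<Sum>m<Suc L. ?t (L - m))"
    using sum.nat_diff_reindex [of ?t "Suc L"] by simp
  also have "\<dots> = (\<Sum>m\<le>L. pochhammer \<mu> (L - m) / fact (L - m) * f (x + real m * \<delta>))"
    unfolding lessThan_Suc_atMost by (intro sum.cong refl) (simp add: of_nat_diff algebra_simps)
  finally show "suminf ?t =
      (\<Sum>m. pochhammer \<mu> (Suc m + L) / fact (Suc m + L) * f (x - real (Suc m) * \<delta>)) +
      (\<Sum>m\<le>L. pochhammer \<mu> (L - m) / fact (L - m) * f (x + real m * \<delta>))"
    using suminf_split_initial_segment [OF s, of "Suc L"] unfolding tail by simp
qed

text \<open>Put l = N-n-i, so that l+n = N-i, and exchange the sums. The condition m <= N-i becomes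
  i <= N-m, which together with i <= N-n gives the minimum.\<close>

lemma sum_triangle_reflect:
  fixes g :: "nat \<Rightarrow> 'a::comm_semiring_0" and v :: "nat \<Rightarrow> 'a"
  assumes "n \<le> N"
  shows "(\<Sum>l\<le>N - n. v l * (\<Sum>m\<le>l + n. e (l + n - m) * g m)) =
    (\<Sum>m\<le>N. g m * (\<Sum>i\<le>min (N - n) (N - m). v (N - n - i) * e (N - m - i)))"
proof -
  let ?M = "N - n"
  have "(\<Sum>l\<le>?M. v l * (\<Sum>m\<le>l + n. e (l + n - m) * g m)) =
    (\<Sum>i\<le>?M. v (?M - i) * (\<Sum>m\<le>N - i. e (N - i - m) * g m))"
    using assms
    by (intro sum.reindex_bij_witness [of _ "\<lambda>i. ?M - i" "\<lambda>i. ?M - i"]) (auto simp: add.commute intro!: sum.cong)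
  \<comment> \<open>Padding with zeros to a rectangle makes the two ranges independent.\<close>
  also have "\<dots> = (\<Sum>i\<le>?M. \<Sum>m\<in>{..N}. if m \<le> N - i then v (?M - i) * (e (N - i - m) * g m) else 0)"
    unfolding sum_distrib_left
    by (intro sum.cong refl sum.mono_neutral_cong_left) auto
  also have "\<dots> = (\<Sum>m\<le>N. \<Sum>i\<le>?M. if m \<le> N - i then v (?M - i) * (e (N - i - m) * g m) else 0)"
    by (rule sum.swap)
  also have "\<dots> = (\<Sum>m\<le>N. g m * (\<Sum>i\<le>min ?M (N - m). v (?M - i) * e (N - m - i)))"
    unfolding sum_distrib_left
    by (rule sum.cong [OF refl], rule sum.mono_neutral_cong_right) (auto simp: mult_ac add.commute)
  finally show ?thesis .
qed

text \<open>Convergence of the backward series is part of the conclusion, so its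
  \<open>suminf\<close> is a genuine sum. The argument \<open>Suc m\<close> encodes the start at m =
  1.\<close>

theorem mainTheorem5:
  fixes n N :: nat and \<alpha> \<beta> \<delta> :: real and \<nu> :: complex and f :: "real \<Rightarrow> complex" and x :: real
  assumes "1 \<le> n" and "n \<le> N"
    and "\<alpha> > -1" and "\<beta> > -1" and "\<delta> > 0" and "Re \<nu> < real n"
    and "\<And>y. frac_summable \<delta> (of_nat n - \<nu>) f y"
  defines "S \<equiv> \<lambda>m::nat. f (x - real m * \<delta>) * (pochhammer (- \<nu>) (m + n) / fact (m + n)) *
      hyp3F2 (N - n)
        (of_nat n - of_nat N) (of_nat n + of_real \<alpha> + 1) (of_nat m + of_nat n - \<nu>)
        (- of_nat N - of_real \<beta>) (of_nat m + of_nat n + 1)"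
  shows "summable (\<lambda>m. S (Suc m)) \<and>
    hahn_difference \<alpha> \<beta> N n \<delta> \<nu> f x =
      of_real (Gamma (2 * real n + \<alpha> + \<beta> + 2) / Gamma (real N + real n + \<alpha> + \<beta> + 2) *
        (Gamma (real N + 1 + \<beta>) / Gamma (real n + 1 + \<beta>))) *
        (1 / of_real \<delta> powr \<nu>) * (\<Sum>m. S (Suc m))
    + of_real (Gamma (2 * real n + \<alpha> + \<beta> + 2) / Gamma (real N + real n + \<alpha> + \<beta> + 2) *
        (Gamma (\<alpha> + real N + 1) / Gamma (\<alpha> + real n + 1))) *
        (1 / of_real \<delta> powr \<nu>) *
        (\<Sum>m\<le>N. f (x + real m * \<delta>) * forward_coeff \<alpha> \<beta> N n m \<nu>)"
proof -
  let ?M = "N - n"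
  define c where "c = pochhammer (2 * real n + \<alpha> + \<beta> + 2) ?M"
  define cb where "cb = pochhammer (\<beta> + real n + 1) ?M"
  define ca where "ca = pochhammer (\<alpha> + real n + 1) ?M"
  define v where "v l = complex_of_real (hahn_weight (\<alpha> + real n) (\<beta> + real n) ?M l)" for l
  define e where "e k = pochhammer (- \<nu>) k / fact k" for k
  \<comment> \<open>The part of the series based at x + (l+n)\<delta> that reaches points to the
    left of x.\<close>
  define T where "T l m = e (Suc m + (l + n)) * f (x - real (Suc m) * \<delta>)" for l m
  have c: "Gamma (2 * real n + \<alpha> + \<beta> + 2) / Gamma (real N + real n + \<alpha> + \<beta> + 2) = 1 / c"
    using Gamma_ratio_eq_pochhammer [of "2 * real n + \<alpha> + \<beta> + 2" n N] assms(1-4)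
    unfolding c_def by (simp add: add_ac divide_simps split: if_splits)
  have cb: "Gamma (real N + 1 + \<beta>) / Gamma (real n + 1 + \<beta>) = cb"
    using Gamma_ratio_eq_pochhammer [of "\<beta> + real n + 1" n N] assms(1-4)
    unfolding cb_def by (simp add: add_ac)
  have ca: "Gamma (\<alpha> + real N + 1) / Gamma (\<alpha> + real n + 1) = ca"
    using Gamma_ratio_eq_pochhammer [of "\<alpha> + real n + 1" n N] assms(1-4)
    unfolding ca_def by (simp add: add_ac)
  have "cb > 0" unfolding cb_def using assms(4) by (intro pochhammer_pos) simp
  have summ: "frac_summable \<delta> (- \<nu>) f y" for y
    by (rule hahn_difference_eq_sum(1) [OF assms(1-5,7)])
  have sT: "summable (T l)" for l
    unfolding T_def e_def by (rule frac_series_split(1) [OF summ])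
  have S: "of_real cb * S (Suc m) = fact ?M * (\<Sum>l\<le>?M. v l * T l m)" for m
  proof -
    have "of_real cb * S (Suc m) = f (x - real (Suc m) * \<delta>) *
      (fact ?M * (\<Sum>l\<le>?M. v l * e (Suc m + n + l)))"
      unfolding S_def v_def e_def cb_def backward_sum [OF assms(2,4), symmetric] by (simp only: mult_ac)
    also have "\<dots> = fact ?M * (\<Sum>l\<le>?M. v l * T l m)"
      by (simp add: T_def sum_distrib_left mult_ac add_ac)
    finally show ?thesis .
  qed
  \<comment> \<open>Each term is a fixed finite combination of terms of convergent series;
    \<open>cb\<close> is nonzero and can be divided out.\<close>
  have sS: "summable (\<lambda>m. of_real cb * S (Suc m))"
    unfolding S by (intro summable_mult summable_sum sT)
  then have "summable (\<lambda>m. S (Suc m))"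
    using \<open>cb > 0\<close> by (simp add: summable_cmult_iff)
  have backward: "fact ?M * (\<Sum>l\<le>?M. v l * suminf (T l)) = of_real cb * (\<Sum>m. S (Suc m))"
  proof -
    have "of_real cb * (\<Sum>m. S (Suc m)) = (\<Sum>m. of_real cb * S (Suc m))"
      using \<open>summable (\<lambda>m. S (Suc m))\<close> by (rule suminf_mult [symmetric])
    also have "\<dots> = fact ?M * (\<Sum>m. \<Sum>l\<le>?M. v l * T l m)"
      unfolding S by (intro suminf_mult summable_sum summable_mult sT)
    also have "(\<Sum>m. \<Sum>l\<le>?M. v l * T l m) = (\<Sum>l\<le>?M. \<Sum>m. v l * T l m)"
      by (intro suminf_sum summable_mult sT)
    also have "\<dots> = (\<Sum>l\<le>?M. v l * suminf (T l))"
      by (intro sum.cong refl suminf_mult sT)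
    finally show ?thesis by simp
  qed
  have forward: "fact ?M * (\<Sum>l\<le>?M. v l * (\<Sum>m\<le>l + n. e (l + n - m) * f (x + real m * \<delta>))) =
    of_real ca * (\<Sum>m\<le>N. f (x + real m * \<delta>) * forward_coeff \<alpha> \<beta> N n m \<nu>)"
  proof -
    \<comment> \<open>Reversing the order of the weights exchanges \<alpha> and \<beta>, hence
      \<open>ca\<close> here where the backward part has \<open>cb\<close>.\<close>
    have *: "fact ?M * (\<Sum>i\<le>min ?M (N - m). v (?M - i) * e (N - m - i)) =
      of_real ca * forward_coeff \<alpha> \<beta> N n m \<nu>" if "m \<le> N" for m
    proof -
      have "(\<Sum>i\<le>min ?M (N - m). v (?M - i) * e (N - m - i)) =
        (\<Sum>i\<le>min ?M (N - m). of_real (hahn_weight (\<beta> + real n) (\<alpha> + real n) ?M i) *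
          (pochhammer (- \<nu>) (N - m - i) / fact (N - m - i)))"
        unfolding v_def e_def by (intro sum.cong refl) (simp only: atMost_iff min.bounded_iff hahn_weight_reflect)
      then show ?thesis
        unfolding ca_def forward_sum [OF assms(2) that assms(3)] by simp
    qed
    have "fact ?M * (\<Sum>l\<le>?M. v l * (\<Sum>m\<le>l + n. e (l + n - m) * f (x + real m * \<delta>))) =
      fact ?M * (\<Sum>m\<le>N. f (x + real m * \<delta>) * (\<Sum>i\<le>min ?M (N - m). v (?M - i) * e (N - m - i)))"
      by (rule arg_cong [OF sum_triangle_reflect [OF assms(2)]])
    also have "\<dots> = (\<Sum>m\<le>N. f (x + real m * \<delta>) * (of_real ca * forward_coeff \<alpha> \<beta> N n m \<nu>))"
      by (subst sum_distrib_left, rule sum.cong [OF refl]) (subst mult.left_commute, simp only: * atMost_iff)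
    finally show ?thesis
      by (simp add: sum_distrib_left mult_ac)
  qed
  have "hahn_difference \<alpha> \<beta> N n \<delta> \<nu> f x = 1 / of_real \<delta> powr \<nu> * of_real (fact ?M / c) *
    (\<Sum>l\<le>?M. v l * (suminf (T l) + (\<Sum>m\<le>l + n. e (l + n - m) * f (x + real m * \<delta>))))"
    unfolding hahn_difference_eq_sum(2) [OF assms(1-5,7)] frac_series_split(2) [OF summ]
      c_def v_def T_def e_def ..
  also have "\<dots> = 1 / of_real \<delta> powr \<nu> * of_real (1 / c) *
    (fact ?M * (\<Sum>l\<le>?M. v l * suminf (T l)) +
     fact ?M * (\<Sum>l\<le>?M. v l * (\<Sum>m\<le>l + n. e (l + n - m) * f (x + real m * \<delta>))))"
    by (simp add: distrib_left sum.distrib)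
  also have "\<dots> = of_real (1 / c * cb) * (1 / of_real \<delta> powr \<nu>) * (\<Sum>m. S (Suc m)) +
    of_real (1 / c * ca) * (1 / of_real \<delta> powr \<nu>) *
      (\<Sum>m\<le>N. f (x + real m * \<delta>) * forward_coeff \<alpha> \<beta> N n m \<nu>)"
    unfolding backward forward by (simp add: distrib_left mult_ac)
  finally show ?thesis
    using \<open>summable (\<lambda>m. S (Suc m))\<close> unfolding c cb ca by blast
qed

end
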